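(* Let $A$ be a finite alphabet. The coloured non-commutative power sum functions $P_I$, indexed by sentences $I$ over $A$, form a linear basis of $\mathrm{NSym}_A$; in particular, for every non-empty word $w$ over $A$, $$H_{(w)}=\sum_{I\preccurlyeq(w)}\frac{1}{\ell(I)!}P_I .$$
   Context: $\Bbbk$ is a field of characteristic zero. A sentence $I=(w_1,\dots,w_m)$ over $A$ is a finite sequence of non-empty words in letters of $A$; $\ell(I)=m$; $1$ is the empty sentence; $I\cdot J$ is concatenation of sequences of words. Write $J\preccurlyeq I$ ($J$ refines $I$) if the words of $I$ can be obtained by concatenating adjacent words of $J$. $\mathrm{NSym}_A$ is the $\Bbbk$-algebra with linear basis $(H_I)$ indexed by sentences over $A$, product $H_IH_J=H_{I\cdot J}$ and unit $H_1=1$. For a non-empty word $w$ define $$P_{(w)}=\sum_{I\preccurlyeq(w)}\frac{(-1)^{\ell(I)-1}}{\ell(I)}H_I,$$ put $P_1=1$ for the empty sentence, and for a non-empty sentence $I=(w_1,\dots,w_{\ell(I)})$ put $P_I=P_{(w_1)}P_{(w_2)}\cdots P_{(w_{\ell(I)})}$. *)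

theory Defs
  imports Complex_Main "HOL-Library.Poly_Mapping"
begin

typedef 'a sentence = "{ws :: 'a list list. [] \<notin> set ws}"
  morphisms words Sentence
  by (rule exI[of _ "[]"]) simp

setup_lifting type_definition_sentence

instantiation sentence :: (type) monoid_add
begin

text \<open>The monoid of sentences is written additively because \<^theory>\<open>HOL-Library.Poly_Mapping\<close>
  takes exponents in an additive monoid; it is not commutative.\<close>

lift_definition zero_sentence :: "'a sentence" is "[]" by simp

lift_definition plus_sentence :: "'a sentence \<Rightarrow> 'a sentence \<Rightarrow> 'a sentence" is "(@)" by simp

instance by (standard; transfer; simp)

end

definition slen :: "'a sentence \<Rightarrow> nat" where
  "slen I = length (words I)"

text \<open>The one-word sentence; the value at the empty list, which is not a word, is irrelevant.\<close>
lift_definition word_sentence :: "'a list \<Rightarrow> 'a sentence" is "\<lambda>w. if w = [] then [] else [w]"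
  by simp

definition sentences_over :: "'a set \<Rightarrow> 'a sentence set" where
  "sentences_over A = {I. \<forall>w\<in>set (words I). set w \<subseteq> A}"

text \<open>\<open>J\<close> refines \<open>I\<close>: cut \<open>J\<close> into consecutive blocks and concatenate the words of each block.
  The blocks are automatically non-empty, since the words of \<open>I\<close> are.\<close>
definition refines :: "'a sentence \<Rightarrow> 'a sentence \<Rightarrow> bool" (infix "\<preceq>r" 50) where
  "J \<preceq>r I \<longleftrightarrow> (\<exists>Bs. concat Bs = words J \<and> map concat Bs = words I)"

lemma words_word_sentence: "w \<noteq> [] \<Longrightarrow> words (word_sentence w) = [w]"
  by transfer simp

lemma refines_word_sentence_iff:
  assumes "w \<noteq> []"
  shows "J \<preceq>r word_sentence w \<longleftrightarrow> concat (words J) = w"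
proof -
  have "(\<exists>Bs. concat Bs = ws \<and> map concat Bs = [w]) \<longleftrightarrow> concat ws = w" for ws
    by (auto simp: map_eq_Cons_conv intro: exI[of _ "[ws]"])
  then show ?thesis
    using assms by (simp add: refines_def words_word_sentence)
qed

lemma finite_refines_word_sentence:
  assumes "w \<noteq> []"
  shows "finite {J. J \<preceq>r word_sentence w}"
proof -
  have len: "length ws \<le> length (concat ws)" if "[] \<notin> set ws" for ws :: "'a list list"
    using that by (induction ws) (auto simp: Suc_le_eq add_strict_increasing neq_Nil_conv)
  have len': "length v \<le> length (concat ws)" if "v \<in> set ws" for v and ws :: "'a list list"
    using that by (induction ws) auto
  define V where "V = {v. set v \<subseteq> set w \<and> length v \<le> length w}"
  have "finite V"
    unfolding V_def by (rule finite_lists_length_le) simp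
  then have "finite {ws. set ws \<subseteq> V \<and> length ws \<le> length w}"
    by (rule finite_lists_length_le)
  moreover have "words ` {J. J \<preceq>r word_sentence w} \<subseteq> {ws. set ws \<subseteq> V \<and> length ws \<le> length w}"
    using assms words len len' by (force simp: refines_word_sentence_iff V_def)
  ultimately have "finite (words ` {J. J \<preceq>r word_sentence w})"
    by (rule finite_subset[rotated])
  then show ?thesis
    by (rule finite_imageD) (simp add: inj_on_def words_inject)
qed

text \<open>\<open>NSym\<^sub>A\<close> is the monoid algebra of the sentences over \<open>A\<close>. It is taken as a subalgebra of the
  monoid algebra of all sentences over the ambient type of letters, whose ring structure is the
  convolution product of \<^theory>\<open>HOL-Library.Poly_Mapping\<close>.\<close>
type_synonym ('a, 'k) nsym = "'a sentence \<Rightarrow>\<^sub>0 'k"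

definition NSym :: "'a set \<Rightarrow> ('a, 'k::field_char_0) nsym set" where
  "NSym A = {f. Poly_Mapping.keys f \<subseteq> sentences_over A}"

definition nsym_scale :: "'k::field_char_0 \<Rightarrow> ('a, 'k) nsym \<Rightarrow> ('a, 'k) nsym" (infixr "*\<^sub>N" 75) where
  "c *\<^sub>N f = Poly_Mapping.map ((*) c) f"

definition nsym_H :: "'a sentence \<Rightarrow> ('a, 'k::field_char_0) nsym" where
  "nsym_H I = Poly_Mapping.single I 1"

lemma lookup_nsym_scale [simp]: "Poly_Mapping.lookup (c *\<^sub>N f) I = c * Poly_Mapping.lookup f I"
  by (simp add: nsym_scale_def Poly_Mapping.map.rep_eq when_def)

global_interpretation nsym: vector_space nsym_scale
  by standard (auto intro!: poly_mapping_eqI simp: lookup_add algebra_simps)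

lemma nsym_scale_eq_mult: "c *\<^sub>N f = Poly_Mapping.single 0 c * f"
  by (simp add: nsym_scale_def mult_map_scale_conv_mult)

lemma nsym_scale_mult_left: "(c *\<^sub>N f) * g = c *\<^sub>N (f * g)"
  by (simp add: nsym_scale_eq_mult mult.assoc)

lemma nsym_H_mult: "nsym_H I * nsym_H J = nsym_H (I + J)"
  by (simp add: nsym_H_def mult_single)

lemma nsym_H_0: "nsym_H 0 = 1"
  by (simp add: nsym_H_def)

lemma inj_nsym_H: "inj nsym_H"
proof (rule injI)
  fix I J :: "'a sentence"
  assume "(nsym_H I :: ('a, 'k::field_char_0) nsym) = nsym_H J"
  then have "Poly_Mapping.keys (nsym_H I :: ('a, 'k) nsym) = Poly_Mapping.keys (nsym_H J :: ('a, 'k) nsym)"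
    by simp
  then show "I = J" by (simp add: nsym_H_def)
qed

lemma subspace_NSym: "nsym.subspace (NSym A)"
proof (rule nsym.subspaceI)
  show "x + y \<in> NSym A" if "x \<in> NSym A" "y \<in> NSym A" for x y
    using that keys_add[of x y] by (auto simp: NSym_def)
  show "c *\<^sub>N x \<in> NSym A" if "x \<in> NSym A" for c x
    using that by (auto simp: NSym_def in_keys_iff subset_iff)
qed (simp add: NSym_def)

lemma NSym_1: "1 \<in> NSym A"
  by (simp add: NSym_def sentences_over_def zero_sentence.rep_eq)

lemma NSym_mult: "f \<in> NSym A \<Longrightarrow> g \<in> NSym A \<Longrightarrow> f * g \<in> NSym A"
  using keys_mult[of f g] by (fastforce simp: NSym_def sentences_over_def plus_sentence.rep_eq)

lemma nsym_H_expansion: "f = (\<Sum>I\<in>Poly_Mapping.keys f. Poly_Mapping.lookup f I *\<^sub>N nsym_H I)"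
proof (rule poly_mapping_eqI)
  fix J
  have "Poly_Mapping.lookup (\<Sum>I\<in>Poly_Mapping.keys f. Poly_Mapping.lookup f I *\<^sub>N nsym_H I) J
      = (\<Sum>I\<in>Poly_Mapping.keys f. if I = J then Poly_Mapping.lookup f I else 0)"
    unfolding lookup_sum by (rule sum.cong) (auto simp: nsym_H_def lookup_single when_def)
  also have "\<dots> = Poly_Mapping.lookup f J"
    by (simp add: sum.delta in_keys_iff)
  finally show "Poly_Mapping.lookup f J
      = Poly_Mapping.lookup (\<Sum>I\<in>Poly_Mapping.keys f. Poly_Mapping.lookup f I *\<^sub>N nsym_H I) J" ..
qed

lemma nsym_scale_mult_right:
  fixes c :: "'k::field_char_0"
  shows "f * (c *\<^sub>N g) = c *\<^sub>N (f * g)"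
proof -
  have "f * Poly_Mapping.single 0 c
      = (\<Sum>I\<in>Poly_Mapping.keys f. Poly_Mapping.lookup f I *\<^sub>N nsym_H I) * Poly_Mapping.single 0 c"
    by (simp flip: nsym_H_expansion)
  also have "\<dots> = Poly_Mapping.single 0 c
      * (\<Sum>I\<in>Poly_Mapping.keys f. Poly_Mapping.lookup f I *\<^sub>N nsym_H I)"
    by (simp add: nsym_scale_eq_mult nsym_H_def mult_single sum_distrib_left sum_distrib_right
        mult.commute)
  also have "\<dots> = Poly_Mapping.single 0 c * f"
    by (simp flip: nsym_H_expansion)
  finally show ?thesis
    unfolding nsym_scale_eq_mult by (simp flip: mult.assoc)
qed

lemma span_nsym_H: "nsym.span (nsym_H ` sentences_over A) = NSym A"
proof (rule nsym.span_unique)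
  show "nsym_H ` sentences_over A \<subseteq> NSym A"
    by (auto simp: NSym_def nsym_H_def)
  show "nsym.subspace (NSym A)"
    by (rule subspace_NSym)
  fix V :: "('a, 'k::field_char_0) nsym set"
  assume V: "nsym_H ` sentences_over A \<subseteq> V" "nsym.subspace V"
  show "NSym A \<subseteq> V"
  proof
    fix f :: "('a, 'k) nsym"
    assume "f \<in> NSym A"
    then have "(\<Sum>I\<in>Poly_Mapping.keys f. Poly_Mapping.lookup f I *\<^sub>N nsym_H I) \<in> V"
      using V by (intro nsym.subspace_sum nsym.subspace_scale) (auto simp: NSym_def)
    then show "f \<in> V"
      by (simp flip: nsym_H_expansion)
  qed
qed

lemma independent_nsym_H:
  fixes S :: "'a sentence set"
  shows "nsym.independent (nsym_H ` S)"
proof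
  assume "nsym.dependent (nsym_H ` S :: ('a, 'k::field_char_0) nsym set)"
  then obtain T and u :: "('a, 'k) nsym \<Rightarrow> 'k" and v
    where T: "finite T" "T \<subseteq> nsym_H ` S" "(\<Sum>x\<in>T. u x *\<^sub>N x) = 0" and v: "v \<in> T" "u v \<noteq> 0"
    unfolding nsym.dependent_explicit by blast
  then obtain I where I: "v = nsym_H I" by auto
  have "0 = (\<Sum>x\<in>T. Poly_Mapping.lookup (u x *\<^sub>N x) I)"
    using arg_cong[OF T(3), of "\<lambda>f. Poly_Mapping.lookup f I"] by (simp add: lookup_sum)
  also have "\<dots> = (\<Sum>x\<in>T. if x = v then u x else 0)"
  proof (rule sum.cong)
    fix x
    assume "x \<in> T"
    then obtain J where "x = nsym_H J" using T(2) by blast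
    then show "Poly_Mapping.lookup (u x *\<^sub>N x) I = (if x = v then u x else 0)"
      unfolding I using inj_eq[OF inj_nsym_H, of J I] by (auto simp: nsym_H_def lookup_single when_def)
  qed simp
  also have "\<dots> = u v"
    using T(1) v(1) by simp
  finally show False using v(2) by simp
qed

text \<open>For a non-empty word \<open>w\<close> this is \<open>P\<^bsub>(w)\<^esub>\<close>; it is only used for such \<open>w\<close>.\<close>
definition nsym_P_word :: "'a list \<Rightarrow> ('a, 'k::field_char_0) nsym" where
  "nsym_P_word w = (\<Sum>I | I \<preceq>r word_sentence w. ((-1) ^ (slen I - 1) / of_nat (slen I)) *\<^sub>N nsym_H I)"

definition nsym_P :: "'a sentence \<Rightarrow> ('a, 'k::field_char_0) nsym" where
  "nsym_P I = prod_list (map nsym_P_word (words I))"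

end

theory Submission
  imports Defs "HOL-Computational_Algebra.Formal_Power_Series"
begin

text \<open>Scalar power series can be evaluated at a series whose coefficients are indexed by words, words
  being multiplied by concatenation, and evaluation respects products and composition. If \<open>h\<close> is the
  series with coefficient \<open>H\<^bsub>(w)\<^esub>\<close> at \<open>w\<close>, then \<open>P\<^bsub>(w)\<^esub>\<close> is the coefficient of \<open>ln (1 + h)\<close> at \<open>w\<close>,
  and the expansion of \<open>H\<^bsub>(w)\<^esub>\<close> is \<open>exp (ln (1 + h)) = 1 + h\<close>. Hence the \<open>P\<^sub>I\<close> span. They are
  independent because \<open>P\<^sub>I\<close> is \<open>H\<^sub>I\<close> plus terms indexed by longer sentences.\<close>

section \<open>Factorizations of a word into non-empty words\<close>

definition factorizations :: "'a list \<Rightarrow> 'a list list set" where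
  "factorizations w = {ws. [] \<notin> set ws \<and> concat ws = w}"

lemma length_le_concat: "[] \<notin> set ws \<Longrightarrow> length ws \<le> length (concat ws)"
  by (induction ws) (auto simp: Suc_le_eq add_strict_increasing neq_Nil_conv)

lemma length_factorization: "ws \<in> factorizations w \<Longrightarrow> length ws \<le> length w"
  using length_le_concat by (auto simp: factorizations_def)

lemma factorizations_Nil [simp]: "factorizations [] = {[]}"
  by (auto simp: factorizations_def) (metis list.set_intros(1) neq_Nil_conv)

text \<open>This turns sums over refinements of \<open>(w)\<close> into sums over plain lists, which
  can be cut and joined without carrying the type invariant along.\<close>

lemma words_image_refines:
  assumes "w \<noteq> []"
  shows "words ` {I. I \<preceq>r word_sentence w} = factorizations w"
proof -
  have "ws \<in> words ` {I. concat (words I) = w}" if "ws \<in> factorizations w" for ws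
    using that by (intro image_eqI[of _ _ "Sentence ws"]) (auto simp: factorizations_def Sentence_inverse)
  then show ?thesis
    using assms words by (auto simp: refines_word_sentence_iff factorizations_def)
qed

lemma finite_factorizations [simp]: "finite (factorizations w)"
proof (cases "w = []")
  case False
  then show ?thesis
    using finite_imageI[OF finite_refines_word_sentence, of w words] by (simp add: words_image_refines)
qed simp

text \<open>Cutting a factorization of \<open>w\<close> between two of its words amounts to cutting
  \<open>w\<close> between two letters and factorizing both halves. The cut after \<open>i\<close>
  words falls after \<open>k\<close> letters, the total length of those words.\<close>

lemma sum_factorizations_split:
  fixes w :: "'a list"
  shows "(\<Sum>ws\<in>factorizations w. \<Sum>i\<le>length ws. g (take i ws) (drop i ws))
    = (\<Sum>k\<le>length w. \<Sum>us\<in>factorizations (take k w). \<Sum>vs\<in>factorizations (drop k w). g us vs)"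
proof -
  have concat_split: "concat (take i ws) @ concat (drop i ws) = concat ws" for i and ws :: "'a list list"
    by (simp flip: concat_append)
  have take_concat: "take (length (concat (take i ws))) (concat ws) = concat (take i ws)"
    and drop_concat: "drop (length (concat (take i ws))) (concat ws) = concat (drop i ws)"
    and length_concat_take: "length (concat (take i ws)) \<le> length (concat ws)" for i and ws :: "'a list list"
    unfolding concat_split[of i ws, symmetric] by simp_all
  have concat_halves: "concat us @ concat vs = w" "length (concat us) = k"
    if "concat us = take k w" "concat vs = drop k w" "k \<le> length w" for us vs k
    using that by simp_all
  have "(\<Sum>ws\<in>factorizations w. \<Sum>i\<le>length ws. g (take i ws) (drop i ws))
      = (\<Sum>(ws, i)\<in>Sigma (factorizations w) (\<lambda>ws. {..length ws}). g (take i ws) (drop i ws))"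
    by (simp add: sum.Sigma)
  also have "\<dots> = (\<Sum>(k, us, vs)\<in>Sigma {..length w} (\<lambda>k. factorizations (take k w) \<times> factorizations (drop k w)). g us vs)"
    by (rule sum.reindex_bij_witness[of _ "\<lambda>(k, us, vs). (us @ vs, length us)"
          "\<lambda>(ws, i). (length (concat (take i ws)), take i ws, drop i ws)"])
      (auto simp: factorizations_def take_concat drop_concat concat_halves
        dest: in_set_takeD in_set_dropD intro: length_concat_take)
  also have "\<dots> = (\<Sum>k\<le>length w. \<Sum>us\<in>factorizations (take k w). \<Sum>vs\<in>factorizations (drop k w). g us vs)"
    by (simp add: sum.Sigma sum.cartesian_product case_prod_beta)
  finally show ?thesis .
qed

text \<open>The first word is split off. Its length \<open>k\<close> starts at 1 because words are
  non-empty.\<close>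

lemma sum_factorizations_Suc:
  "(\<Sum>ws | ws \<in> factorizations w \<and> length ws = Suc n. f ws)
    = (\<Sum>k\<in>{1..length w}. \<Sum>ws | ws \<in> factorizations (drop k w) \<and> length ws = n. f (take k w # ws))"
proof -
  have "(\<Sum>ws | ws \<in> factorizations w \<and> length ws = Suc n. f ws)
     = (\<Sum>(k, ws)\<in>Sigma {1..length w} (\<lambda>k. {ws \<in> factorizations (drop k w). length ws = n}). f (take k w # ws))"
    by (rule sum.reindex_bij_witness[of _ "\<lambda>(k, ws). take k w # ws" "\<lambda>ws. (length (hd ws), tl ws)"])
      (auto simp: factorizations_def length_Suc_conv Suc_le_eq)
  then show ?thesis
    by (simp add: sum.Sigma)
qed

section \<open>Evaluation of scalar power series at series in words\<close>

text \<open>The scalar series \<open>a\<close> evaluated at the series \<open>h\<close> in words, where words multiply by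
  concatenation: the coefficient at the word \<open>w\<close>. The value \<open>h []\<close> is never used, so \<open>h\<close> counts as
  having no constant term.\<close>
definition word_subst :: "'k fps \<Rightarrow> ('a list \<Rightarrow> ('a, 'k::field_char_0) nsym) \<Rightarrow> 'a list \<Rightarrow> ('a, 'k) nsym" where
  "word_subst a h w = (\<Sum>ws\<in>factorizations w. fps_nth a (length ws) *\<^sub>N prod_list (map h ws))"

lemma sum_refines_word_subst:
  assumes "w \<noteq> []"
  shows "(\<Sum>I | I \<preceq>r word_sentence w. fps_nth a (slen I) *\<^sub>N prod_list (map h (words I)))
    = word_subst a h w"
  unfolding word_subst_def words_image_refines[OF assms, symmetric] slen_def
  by (subst sum.reindex) (auto simp: inj_on_def words_inject)

text \<open>Scalars are central, so each term of the Cauchy coefficient at \<open>length ws\<close>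
  belongs to one way of cutting \<open>ws\<close> into two parts.\<close>

lemma word_subst_mult:
  "word_subst (a * b) h w = (\<Sum>k\<le>length w. word_subst a h (take k w) * word_subst b h (drop k w))"
proof -
  define g where "g us vs = (fps_nth a (length us) *\<^sub>N prod_list (map h us))
      * (fps_nth b (length vs) *\<^sub>N prod_list (map h vs))" for us vs
  have g: "g (take i ws) (drop i ws)
      = (fps_nth a i * fps_nth b (length ws - i)) *\<^sub>N prod_list (map h ws)" if "i \<le> length ws" for i ws
  proof -
    have "prod_list (map h (take i ws)) * prod_list (map h (drop i ws)) = prod_list (map h ws)"
      by (simp flip: prod_list.append map_append)
    then show ?thesis
      using that by (simp add: g_def nsym_scale_mult_left nsym_scale_mult_right mult.commute)
  qed
  have "word_subst (a * b) h w
      = (\<Sum>ws\<in>factorizations w. \<Sum>i\<le>length ws. g (take i ws) (drop i ws))"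
    by (simp add: word_subst_def fps_mult_nth nsym.scale_sum_left atLeast0AtMost g)
  then show ?thesis
    unfolding sum_factorizations_split by (simp add: word_subst_def g_def sum_product)
qed

text \<open>By induction on \<open>n\<close>, splitting off the first word. Only non-empty factors
  occur on the left, which is harmless because \<open>word_subst a h\<close> vanishes at the empty
  word.\<close>

lemma sum_word_subst_power:
  assumes "fps_nth a 0 = 0"
  shows "(\<Sum>ws | ws \<in> factorizations w \<and> length ws = n. prod_list (map (word_subst a h) ws))
    = word_subst (a ^ n) h w"
proof (induction n arbitrary: w)
  case 0
  have "{ws. ws \<in> factorizations w \<and> ws = []} = (if w = [] then {[]} else {})"
    by (auto simp: factorizations_def)
  \<comment> \<open>\<open>word_subst 1 h\<close> is the unit for convolution: a factorization of a
    non-empty word has positive length, where the series 1 has coefficient 0.\<close>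
  moreover have "word_subst 1 h w = (if w = [] then 1 else 0)"
  proof (cases "w = []")
    case False
    then show ?thesis
      unfolding word_subst_def by (auto simp: factorizations_def intro!: sum.neutral)
  qed (simp add: word_subst_def)
  ultimately show ?case by simp
next
  case (Suc n)
  \<comment> \<open>This removes the term \<open>k = 0\<close> from the convolution.\<close>
  have "word_subst a h [] = 0"
    using assms by (simp add: word_subst_def)
  then have "word_subst (a ^ Suc n) h w
      = (\<Sum>k\<in>{1..length w}. word_subst a h (take k w) * word_subst (a ^ n) h (drop k w))"
    unfolding power_Suc word_subst_mult
    by (intro sum.mono_neutral_right) (auto simp: Suc_le_eq)
  then show ?case
    by (simp add: sum_factorizations_Suc Suc.IH[symmetric] sum_distrib_left)
qed

text \<open>Factorizations are grouped by their number \<open>n\<close> of words; the group of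
  \<open>n\<close> contributes the evaluation of \<open>a ^ n\<close>, weighted by the
  \<open>n\<close>-th coefficient of \<open>b\<close>.\<close>

lemma word_subst_compose:
  assumes "fps_nth a 0 = 0"
  shows "word_subst b (word_subst a h) w = word_subst (b oo a) h w"
proof -
  have "word_subst b (word_subst a h) w = (\<Sum>n\<le>length w. \<Sum>ws | ws \<in> factorizations w \<and> length ws = n.
      fps_nth b (length ws) *\<^sub>N prod_list (map (word_subst a h) ws))"
    unfolding word_subst_def[of b]
    by (rule sum.group[symmetric]) (auto dest: length_factorization)
  also have "\<dots> = (\<Sum>n\<le>length w. fps_nth b n *\<^sub>N word_subst (a ^ n) h w)"
    by (simp add: sum_word_subst_power[OF assms, symmetric] nsym.scale_sum_right)
  also have "\<dots> = (\<Sum>ws\<in>factorizations w. (\<Sum>n\<le>length w. fps_nth b n * fps_nth (a ^ n) (length ws))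
      *\<^sub>N prod_list (map h ws))"
    unfolding word_subst_def nsym.scale_sum_right nsym.scale_sum_left nsym.scale_scale
    by (rule sum.swap)
  also have "\<dots> = word_subst (b oo a) h w"
  proof -
    have "(\<Sum>n\<le>length w. fps_nth b n * fps_nth (a ^ n) (length ws)) = fps_nth (b oo a) (length ws)"
      if "ws \<in> factorizations w" for ws
      \<comment> \<open>The composition sums only over \<open>n\<close> up to
        \<open>length ws\<close>. The further terms vanish, since \<open>a ^ n\<close> has no
        coefficient below degree \<open>n\<close>.\<close>
      unfolding fps_compose_nth
      using length_factorization[OF that] startsby_zero_power_prefix[OF assms]
      by (intro sum.mono_neutral_right) auto
    then show ?thesis
      by (simp add: word_subst_def)
  qed
  finally show ?thesis .
qed

section \<open>Logarithm and exponential\<close>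

text \<open>\<open>fps_ln 1\<close> is the series of ln(1 + X), the compositional inverse of exp(X)
  - 1.\<close>

lemma fps_exp_compose_ln: "fps_exp 1 oo fps_ln 1 = (1 + fps_X :: 'k::field_char_0 fps)"
proof -
  have "(fps_exp 1 - 1) oo fps_ln (1::'k) = fps_X"
    unfolding fps_ln_fps_exp_inv[OF one_neq_zero] by (rule fps_inv_right) auto
  then show ?thesis
    by (simp add: fps_compose_sub_distrib algebra_simps)
qed

lemma prod_list_nsym_H_word:
  "(prod_list (map (\<lambda>w. nsym_H (word_sentence w)) (words I)) :: ('a, 'k::field_char_0) nsym) = nsym_H I"
proof -
  have "(prod_list (map (\<lambda>w. nsym_H (word_sentence w)) ws) :: ('a, 'k) nsym) = nsym_H (Sentence ws)"
    if "[] \<notin> set ws" for ws :: "'a list list"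
    using that
  proof (induction ws)
    case Nil
    then show ?case by (simp add: zero_sentence_def flip: nsym_H_0)
  next
    case (Cons w ws)
    then have "word_sentence w + Sentence ws = Sentence (w # ws)"
      by (auto simp: plus_sentence.rep_eq words_word_sentence Sentence_inverse simp flip: words_inject)
    with Cons show ?case by (simp add: nsym_H_mult)
  qed
  then show ?thesis
    using words[of I] by (simp add: words_inverse)
qed

lemma nsym_P_word_eq_ln:
  assumes "w \<noteq> []"
  shows "nsym_P_word w = word_subst (fps_ln 1) (\<lambda>w. nsym_H (word_sentence w)) w"
proof -
  have "nsym_P_word w = (\<Sum>I | I \<preceq>r word_sentence w. fps_nth (fps_ln 1) (slen I)
      *\<^sub>N prod_list (map (\<lambda>w. nsym_H (word_sentence w)) (words I)))"
    unfolding nsym_P_word_def prod_list_nsym_H_word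
    using assms by (intro sum.cong) (auto simp: slen_def refines_word_sentence_iff fps_ln_nth)
  then show ?thesis
    by (simp only: sum_refines_word_subst[OF assms])
qed

lemma nsym_H_word_eq_sum_P:
  assumes "w \<noteq> []"
  shows "nsym_H (word_sentence w) = (\<Sum>I | I \<preceq>r word_sentence w. (1 / fact (slen I)) *\<^sub>N nsym_P I)"
    (is "?h w = _")
proof -
  have "(\<Sum>I | I \<preceq>r word_sentence w. (1 / fact (slen I)) *\<^sub>N nsym_P I)
      = (\<Sum>I | I \<preceq>r word_sentence w. fps_nth (fps_exp 1) (slen I)
          *\<^sub>N prod_list (map (word_subst (fps_ln 1) ?h) (words I)))"
    unfolding nsym_P_def using words
    by (intro sum.cong arg_cong2[where f = "(*\<^sub>N)"] arg_cong[where f = prod_list] map_cong nsym_P_word_eq_ln) auto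
  also have "\<dots> = word_subst (1 + fps_X) ?h w"
    by (simp only: sum_refines_word_subst[OF assms] word_subst_compose[OF fps_ln_0] fps_exp_compose_ln)
  \<comment> \<open>The series 1 + X has coefficients only in degrees 0 and 1, and the empty list
    does not factorize a non-empty word.\<close>
  also have "\<dots> = (\<Sum>ws\<in>{[w]}. fps_nth (1 + fps_X) (length ws) *\<^sub>N prod_list (map ?h ws))"
    unfolding word_subst_def using assms
    by (intro sum.mono_neutral_right) (auto simp: fps_X_nth length_Suc_conv, auto simp: factorizations_def)
  finally show ?thesis by simp
qed

section \<open>Unitriangularity and independence\<close>

lemma nsym_P_0 [simp]: "nsym_P 0 = 1"
  by (simp add: nsym_P_def zero_sentence.rep_eq)

lemma nsym_P_add: "nsym_P (I + J) = nsym_P I * nsym_P J"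
  by (simp add: nsym_P_def plus_sentence.rep_eq)

lemma nsym_P_word_sentence: "w \<noteq> [] \<Longrightarrow> nsym_P (word_sentence w) = nsym_P_word w"
  by (simp add: nsym_P_def words_word_sentence)

text \<open>Coefficients at other sentences of the same length as \<open>I\<close> must vanish too,
  so comparing lengths suffices and no total order on sentences enters.\<close>

definition leading_sentence :: "'a sentence \<Rightarrow> ('a, 'k::field_char_0) nsym \<Rightarrow> bool" where
  "leading_sentence I f \<longleftrightarrow> (\<forall>J. slen J \<le> slen I \<longrightarrow> Poly_Mapping.lookup f J = (1 when I = J))"

lemma slen_add [simp]: "slen (I + J) = slen I + slen J"
  by (simp add: slen_def plus_sentence.rep_eq)

lemma leading_sentence_iff:
  "leading_sentence I f \<longleftrightarrow> (\<forall>J\<in>Poly_Mapping.keys (f - nsym_H I). slen I < slen J)"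
proof -
  have "Poly_Mapping.lookup f J = (1 when I = J) \<longleftrightarrow> J \<notin> Poly_Mapping.keys (f - nsym_H I)" for J
    by (simp add: in_keys_iff nsym_H_def lookup_minus lookup_single)
  then show ?thesis
    unfolding leading_sentence_def by (metis not_less)
qed

text \<open>The error of the product is \<open>nsym_H I * s + r * g\<close>, with \<open>r\<close>
  and \<open>s\<close> the errors of the factors. Both summands contain only sentences longer than
  \<open>I + J\<close>, as those in \<open>g\<close> are at least as long as
  \<open>J\<close>.\<close>

lemma leading_sentence_mult:
  assumes "leading_sentence I f" "leading_sentence J g"
  shows "leading_sentence (I + J) (f * g)"
proof -
  define r s where "r = f - nsym_H I" and "s = g - nsym_H J"
  have *: "f * g - nsym_H (I + J) = nsym_H I * s + r * g"
    by (simp add: r_def s_def algebra_simps nsym_H_mult)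
  have g: "slen J \<le> slen K" if "K \<in> Poly_Mapping.keys g" for K
    using that assms(2) by (auto simp: leading_sentence_def in_keys_iff when_def) (metis nat_le_linear)
  have "slen I + slen J < slen K" if "K \<in> Poly_Mapping.keys (nsym_H I * s)" for K
    using that assms(2) keys_mult[of "nsym_H I" s]
    by (auto simp: leading_sentence_iff nsym_H_def s_def)
  moreover have "slen I + slen J < slen K" if "K \<in> Poly_Mapping.keys (r * g)" for K
    using that assms(1) keys_mult[of r g]
    by (auto simp: leading_sentence_iff r_def intro!: add_less_le_mono dest!: g subsetD)
  ultimately show ?thesis
    unfolding leading_sentence_iff * using keys_add[of "nsym_H I * s" "r * g"] by auto
qed

text \<open>The only refinement of \<open>(w)\<close> with at most one word is \<open>(w)\<close>
  itself, and its coefficient is 1.\<close>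

lemma leading_sentence_P_word:
  assumes "w \<noteq> []"
  shows "leading_sentence (word_sentence w) (nsym_P_word w)"
  unfolding leading_sentence_def
proof (intro allI impI)
  fix J :: "'a sentence"
  assume J: "slen J \<le> slen (word_sentence w)"
  have "Poly_Mapping.lookup (nsym_P_word w) J
     = (if J \<preceq>r word_sentence w then (-1) ^ (slen J - 1) / of_nat (slen J) else 0)"
    using assms by (simp add: nsym_P_word_def lookup_sum nsym_H_def lookup_single when_def
        finite_refines_word_sentence if_distrib cong: if_cong)
  moreover have "J \<preceq>r word_sentence w \<longleftrightarrow> word_sentence w = J"
    using J assms by (auto simp: refines_word_sentence_iff slen_def words_word_sentence
        le_Suc_eq length_Suc_conv simp flip: words_inject)
  ultimately show "Poly_Mapping.lookup (nsym_P_word w) J = (1 when word_sentence w = J)"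
    using assms by (auto simp: slen_def words_word_sentence)
qed

lemma sentence_induct [case_names zero add]:
  assumes "Q 0" "\<And>w I. w \<noteq> [] \<Longrightarrow> Q I \<Longrightarrow> Q (word_sentence w + I)"
  shows "Q I"
proof (induction "words I" arbitrary: I)
  case Nil
  then have "I = 0" by (simp add: zero_sentence.rep_eq flip: words_inject)
  then show ?case using assms by simp
next
  case (Cons w ws)
  have "[] \<notin> set (w # ws)" using words[of I] unfolding Cons by simp
  moreover from this have "I = word_sentence w + Sentence ws"
    using words_word_sentence[of w]
    by (auto simp: plus_sentence.rep_eq Sentence_inverse simp flip: words_inject Cons.hyps(2))
  ultimately show ?case using assms(2)[of w] Cons(1)[of "Sentence ws"] by (auto simp: Sentence_inverse)
qed

lemma leading_sentence_P: "leading_sentence I (nsym_P I)"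
proof (induction I rule: sentence_induct)
  case zero
  show ?case by (simp add: leading_sentence_def lookup_one when_def)
next
  case (add w I)
  then show ?case
    by (simp add: nsym_P_add nsym_P_word_sentence leading_sentence_mult leading_sentence_P_word)
qed

lemma inj_leading_sentence:
  fixes b :: "'a sentence \<Rightarrow> ('a, 'k::field_char_0) nsym"
  assumes "\<And>I. leading_sentence I (b I)"
  shows "inj b"
proof (rule injI)
  fix I J
  assume eq: "b I = b J"
  \<comment> \<open>The coefficient at \<open>K\<close> is 1 in \<open>b K\<close>, whereas in
    \<open>b L\<close> it is nonzero only if \<open>K = L\<close>.\<close>
  have "K = L" if "slen K \<le> slen L" "b K = b L" for K L
    using assms[of K] assms[of L] that by (auto simp: leading_sentence_def when_def split: if_splits)
  then show "I = J" using eq by (metis nat_le_linear)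
qed

lemma independent_leading_sentence:
  fixes b :: "'a sentence \<Rightarrow> ('a, 'k::field_char_0) nsym"
  assumes b: "\<And>I. leading_sentence I (b I)"
  shows "nsym.independent (range b)"
proof
  assume "nsym.dependent (range b)"
  then obtain T u where T: "finite T" "T \<subseteq> range b" "(\<Sum>x\<in>T. u x *\<^sub>N x) = 0" "\<exists>v\<in>T. u v \<noteq> 0"
    unfolding nsym.dependent_explicit by blast
  from T(2,4) have "\<exists>I. b I \<in> T \<and> u (b I) \<noteq> 0" by blast
  \<comment> \<open>A shortest sentence in the linear relation: every other \<open>b J\<close> in it
    has coefficient 0 at \<open>I\<close>, so reading off the coefficient at \<open>I\<close>
    isolates \<open>u (b I)\<close>.\<close>
  then obtain I where I: "b I \<in> T" "u (b I) \<noteq> 0"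
    and min: "\<And>J. b J \<in> T \<Longrightarrow> u (b J) \<noteq> 0 \<Longrightarrow> slen I \<le> slen J"
    using ex_has_least_nat[of "\<lambda>I. b I \<in> T \<and> u (b I) \<noteq> 0" _ slen] by blast
  have "0 = (\<Sum>x\<in>T. u x * Poly_Mapping.lookup x I)"
    using arg_cong[OF T(3), of "\<lambda>f. Poly_Mapping.lookup f I"] by (simp add: lookup_sum)
  also have "\<dots> = (\<Sum>x\<in>T. if x = b I then u x else 0)"
  proof (rule sum.cong)
    fix x
    assume "x \<in> T"
    then obtain J where J: "x = b J" using T(2) by blast
    show "u x * Poly_Mapping.lookup x I = (if x = b I then u x else 0)"
      using b[of J] \<open>x \<in> T\<close> min[of J] inj_eq[OF inj_leading_sentence[OF b], of J I]
      unfolding J leading_sentence_def by (cases "u (b J) = 0") (auto simp: when_def)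
  qed simp
  also have "\<dots> = u (b I)"
    using T(1) I(1) by simp
  finally show False using I(2) by simp
qed

section \<open>Restriction to the alphabet and spanning\<close>

lemma refines_word_in_sentences_over:
  assumes "w \<noteq> []" "set w \<subseteq> A" "I \<preceq>r word_sentence w"
  shows "I \<in> sentences_over A"
proof -
  have "set (concat (words I)) \<subseteq> A"
    using assms by (simp add: refines_word_sentence_iff)
  then show ?thesis
    unfolding sentences_over_def by auto
qed

lemma NSym_P_word:
  assumes "w \<noteq> []" "set w \<subseteq> A"
  shows "nsym_P_word w \<in> NSym A"
proof -
  have "nsym_H I \<in> NSym A" if "I \<preceq>r word_sentence w" for I
    using refines_word_in_sentences_over[OF assms that] by (simp add: NSym_def nsym_H_def)
  then show ?thesis
    unfolding nsym_P_word_def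
    by (intro nsym.subspace_sum nsym.subspace_scale subspace_NSym) auto
qed

lemma NSym_P:
  assumes "I \<in> sentences_over A"
  shows "nsym_P I \<in> NSym A"
  using assms
proof (induction I rule: sentence_induct)
  case zero
  show ?case by (simp add: NSym_1)
next
  case (add w I)
  then have "set w \<subseteq> A" "I \<in> sentences_over A"
    by (auto simp: sentences_over_def plus_sentence.rep_eq words_word_sentence)
  with add show ?case
    by (simp add: nsym_P_add nsym_P_word_sentence NSym_mult NSym_P_word)
qed

text \<open>\<open>nsym_P\<close> is multiplicative and sentences over \<open>A\<close> are closed
  under concatenation; bilinearity, by a nested induction over both spans, does the rest.\<close>

lemma span_P_mult:
  assumes "f \<in> nsym.span (nsym_P ` sentences_over A)" "g \<in> nsym.span (nsym_P ` sentences_over A)"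
  shows "f * g \<in> nsym.span (nsym_P ` sentences_over A)"
  using assms(1)
proof (induction rule: nsym.span_induct_alt)
  case base
  show ?case by (simp add: nsym.span_zero)
next
  case (step c x y)
  then obtain I where I: "x = nsym_P I" "I \<in> sentences_over A" by blast
  from assms(2) have "nsym_P I * g \<in> nsym.span (nsym_P ` sentences_over A)"
  proof (induction rule: nsym.span_induct_alt)
    case base
    show ?case by (simp add: nsym.span_zero)
  next
    case (step d x' y')
    then obtain J where J: "x' = nsym_P J" "J \<in> sentences_over A" by blast
    then have "I + J \<in> sentences_over A"
      using I by (auto simp: sentences_over_def plus_sentence.rep_eq)
    with step.IH show ?case
      unfolding J distrib_left nsym_scale_mult_right nsym_P_add[symmetric]
      by (intro nsym.span_add nsym.span_scale) (auto intro: nsym.span_base)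
  qed
  with step.IH show ?case
    unfolding I distrib_right nsym_scale_mult_left by (intro nsym.span_add nsym.span_scale)
qed

text \<open>One-word sentences are covered by the exponential expansion, whose refinements stay over
  \<open>A\<close>. Longer ones are products of these.\<close>

lemma span_P_H:
  assumes "I \<in> sentences_over A"
  shows "(nsym_H I :: ('a, 'k::field_char_0) nsym) \<in> nsym.span (nsym_P ` sentences_over A)"
  using assms
proof (induction I rule: sentence_induct)
  case zero
  then have "(nsym_P 0 :: ('a, 'k) nsym) \<in> nsym.span (nsym_P ` sentences_over A)"
    by (intro nsym.span_base imageI)
  then show ?case by (simp add: nsym_H_0)
next
  case (add w I)
  then have "set w \<subseteq> A" "I \<in> sentences_over A"
    by (auto simp: sentences_over_def plus_sentence.rep_eq words_word_sentence)
  moreover from this have "(nsym_H (word_sentence w) :: ('a, 'k) nsym) \<in> nsym.span (nsym_P ` sentences_over A)"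
    unfolding nsym_H_word_eq_sum_P[OF add.hyps]
    by (intro nsym.span_sum nsym.span_scale nsym.span_base imageI)
      (auto intro: refines_word_in_sentences_over[OF add.hyps])
  ultimately show ?case
    using add.IH by (simp add: span_P_mult flip: nsym_H_mult)
qed

lemma span_P: "nsym.span (nsym_P ` sentences_over A) = NSym A"
proof
  show "nsym.span (nsym_P ` sentences_over A) \<subseteq> NSym A"
    by (intro nsym.span_minimal subspace_NSym) (auto intro: NSym_P)
  show "NSym A \<subseteq> nsym.span (nsym_P ` sentences_over A)"
    unfolding span_nsym_H[symmetric] by (intro nsym.span_minimal) (auto intro: span_P_H)
qed

theorem proposition6p8:
  fixes A :: "'a set"
  assumes "finite A"
  shows "inj_on (nsym_P :: 'a sentence \<Rightarrow> ('a, 'k::field_char_0) nsym) (sentences_over A)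
    \<and> nsym.independent ((nsym_P :: 'a sentence \<Rightarrow> ('a, 'k) nsym) ` sentences_over A)
    \<and> nsym.span ((nsym_P :: 'a sentence \<Rightarrow> ('a, 'k) nsym) ` sentences_over A) = NSym A
    \<and> (\<forall>w. w \<noteq> [] \<and> set w \<subseteq> A \<longrightarrow>
         (nsym_H (word_sentence w) :: ('a, 'k) nsym)
           = (\<Sum>I | I \<preceq>r word_sentence w. (1 / fact (slen I)) *\<^sub>N nsym_P I))"
proof (intro conjI allI impI)
  show "inj_on nsym_P (sentences_over A)"
    using inj_leading_sentence[OF leading_sentence_P] inj_on_subset by blast
  show "nsym.independent (nsym_P ` sentences_over A)"
    using independent_leading_sentence[OF leading_sentence_P]
    by (rule nsym.independent_mono) auto
qed (auto simp: span_P intro: nsym_H_word_eq_sum_P)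

end
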